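(* For every integer $m>0$, the diameter $d_m$ of the level-$m$ cell graph $\Gamma_m$ of the projective octagasket satisfies $d_m\le 2^{m-1}(m+2)-1$.
   Context: Let $\rho=\frac{1}{2+\sqrt2}$ and for $n=0,\dots,7$ let $F_n(x,y)=\rho\,\bigl(x+(1+\sqrt2)\cos\frac{(5-2n)\pi}{8},\; y+(1+\sqrt2)\sin\frac{(5-2n)\pi}{8}\bigr)$. Let $P\subset\mathbb{R}^2$ be the closed filled regular octagon centered at the origin with vertices $V_0=\{(\cos\frac{(5-2n)\pi}{8},\sin\frac{(5-2n)\pi}{8}) : n=0,\dots,7\}$. For a word $w=(j_1,\dots,j_m)\in\{0,\dots,7\}^m$ put $F_w=F_{j_1}\circ\cdots\circ F_{j_m}$ and $P_w=F_w(P)$. The octagons $P_w$ have disjoint interiors and two of them can share a full edge. Level-$m$ cell graph $\Gamma_m$ ($m\ge1$): let $O_m=\bigcup_{|w|=m}P_w$. The complement $\mathbb{R}^2\setminus O_m$ has one unbounded component and finitely many bounded components (the central holes of cells, and the holes, called pseudo-cells, between neighbouring cells). Each component $H$ is centrally symmetric about a point $c_H$ (with $c_H=0$ for the unbounded one). Identify each point $x\in\partial H$ with its antipode $2c_H-x$, for every component $H$. After these identifications each of the 8 edges of each octagon $P_w$ is shared with exactly one other octagon. The $m$-cells are the $8^m$ octagons $P_w$; two distinct $m$-cells are adjacent in $\Gamma_m$ if they share at least one octagon edge after the identifications. A path of length $n$ in $\Gamma_m$ is a sequence $c_0c_1\cdots c_n$ of $m$-cells in which consecutive cells are adjacent and distinct.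 $D_m(w,v)$ is the minimum length of a path with end points $w$ and $v$, and $d_m=\max_{w,v}D_m(w,v)$ is the diameter of $\Gamma_m$. *)

theory Defs
  imports "HOL-Analysis.Analysis" "HOL-Library.Extended_Nat"
begin

text \<open>The plane is \<^typ>\<open>complex\<close>, with the point \<open>(x, y)\<close> written as \<open>Complex x y\<close>.\<close>

definition rho :: real where
  "rho = 1 / (2 + sqrt 2)"

definition F :: "nat \<Rightarrow> complex \<Rightarrow> complex" where
  "F n z = rho *\<^sub>R
     Complex (Re z + (1 + sqrt 2) * cos ((5 - 2 * real n) * pi / 8))
             (Im z + (1 + sqrt 2) * sin ((5 - 2 * real n) * pi / 8))"

definition V0 :: "complex set" where
  "V0 = (\<lambda>n. Complex (cos ((5 - 2 * real n) * pi / 8)) (sin ((5 - 2 * real n) * pi / 8))) ` {0..7::nat}"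

definition P :: "complex set" where
  "P = convex hull V0"

text \<open>For \<open>w = [j\<^sub>1, \<dots>, j\<^sub>m]\<close>, \<open>foldr F w\<close> is \<open>F j\<^sub>1 \<circ> \<dots> \<circ> F j\<^sub>m\<close>.\<close>

definition Pw :: "nat list \<Rightarrow> complex set" where
  "Pw w = foldr F w ` P"

definition cells :: "nat \<Rightarrow> complex set set" where
  "cells m = {Pw w |w. length w = m \<and> set w \<subseteq> {0..7}}"

definition Om :: "nat \<Rightarrow> complex set" where
  "Om m = \<Union> (cells m)"

definition symmetric_about :: "complex set \<Rightarrow> complex \<Rightarrow> bool" where
  "symmetric_about H c \<longleftrightarrow> (\<lambda>x. 2 * c - x) ` H = H"

text \<open>A bounded nonempty set, or one with bounded nonempty complement, has at most one
  centre of symmetry, so \<open>c\<close> below is determined by \<open>H\<close>.\<close>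

definition antipodal :: "nat \<Rightarrow> complex \<Rightarrow> complex \<Rightarrow> bool" where
  "antipodal m x y \<longleftrightarrow>
     (\<exists>H\<in>components (- Om m). \<exists>c. symmetric_about H c \<and> (bounded H \<or> c = 0) \<and>
        x \<in> frontier H \<and> y = 2 * c - x)"

definition glue_class :: "nat \<Rightarrow> complex \<Rightarrow> complex set" where
  "glue_class m x = {y. equivclp (antipodal m) x y}"

text \<open>Sharing an edge after the identifications means that some edges of the two octagons
  have the same image in the quotient.\<close>

definition adjacent :: "nat \<Rightarrow> complex set \<Rightarrow> complex set \<Rightarrow> bool" where
  "adjacent m A B \<longleftrightarrow> A \<in> cells m \<and> B \<in> cells m \<and> A \<noteq> B \<and>
     (\<exists>e e'. e edge_of A \<and> e' edge_of B \<and> glue_class m ` e = glue_class m ` e')"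

definition is_path :: "nat \<Rightarrow> nat \<Rightarrow> (nat \<Rightarrow> complex set) \<Rightarrow> bool" where
  "is_path m n c \<longleftrightarrow> (\<forall>i\<le>n. c i \<in> cells m) \<and> (\<forall>i<n. adjacent m (c i) (c (Suc i)))"

text \<open>Distances are in \<^typ>\<open>enat\<close>, so that cells not joined by any path would be at
  distance \<open>\<infinity>\<close>; the supremum in the diameter ranges over a finite nonempty set and is a maximum.\<close>

definition cell_dist :: "nat \<Rightarrow> complex set \<Rightarrow> complex set \<Rightarrow> enat" where
  "cell_dist m A B = (INF n\<in>{n. \<exists>c. is_path m n c \<and> c 0 = A \<and> c n = B}. enat n)"

definition diam :: "nat \<Rightarrow> enat" where
  "diam m = (SUP A\<in>cells m. SUP B\<in>cells m. cell_dist m A B)"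

end

(* Each F n is the contraction towards vertex n with ratio rho = 1 - sqrt 2 / 2, so a level-m cell is
   split into a ring of eight cells, and for a fixed cell the words ending in q, q, ..., q single out
   its corner at vertex q. Two kinds of adjacency suffice: consecutive cells of a ring meet along an
   edge, which makes their corner cells at both ends of that edge adjacent, and opposite cells n and
   n + 4 of a ring are glued across the central hole at their corners n + 3, n + 4, n + 5. The latter
   gives 2 ^ k - 1 steps between opposite corners of a cell by recursion. Any two cells of a ring are
   joined directly or through one intermediate cell that is entered and left either at the same
   corner or at opposite corners; hence d(k + 1) <= 2 * d(k) + (2 ^ k - 1) + 2.

   The central hole must be an actual component of the complement of Om m, symmetric about the centre
   of its cell. A closed path in Om (k + 1) through the shared vertices of the ring has nonzero winding
   number about 0, so the component of 0 in the complement of Om (k + 1) is bounded; by convexity of P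
   it stays inside P, and since cells have disjoint interiors its images remain components at the
   finer levels. *)

theory Submission
  imports Defs "HOL-Complex_Analysis.Winding_Numbers"
begin

section \<open>The octagon and its contractions\<close>

lemma sqrt_2_bounds: "1.4 < sqrt 2" "sqrt 2 < 1.5"
proof -
  show "1.4 < sqrt 2"
    by (rule real_less_rsqrt) (simp add: power2_eq_square)
  show "sqrt 2 < 1.5"
    by (rule real_less_lsqrt) (simp_all add: power2_eq_square)
qed

text \<open>Since \<open>vert\<close> is 8-periodic, indices and words range over all naturals below, and
  neighbours of \<open>n\<close> are \<open>n + 1\<close> and \<open>n + 7\<close> without any reduction modulo 8.\<close>

definition vert :: "nat \<Rightarrow> complex" where
  "vert n = cis ((5 - 2 * real n) * pi / 8)"

lemma rho_eq: "rho = 1 - sqrt 2 / 2"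
proof -
  have "(1 - sqrt 2 / 2) * (2 + sqrt 2) = 1"
    by (simp add: algebra_simps)
  then show ?thesis
    unfolding rho_def by (metis divide_eq_1_iff nonzero_eq_divide_eq mult_zero_right zero_neq_one)
qed

lemma rho_pos: "0 < rho" and rho_less_half: "2 * rho < 1"
  using sqrt_2_bounds by (simp_all add: rho_eq)

lemma F_eq: "F n z = rho *\<^sub>R z + (1 - rho) *\<^sub>R vert n"
proof -
  have "rho * (1 + sqrt 2) = 1 - rho"
    by (simp add: rho_eq algebra_simps)
  then show ?thesis
    by (simp add: F_def vert_def complex_eq_iff distrib_left flip: mult.assoc)
qed

lemma vert_add_8 [simp]: "vert (n + 8) = vert n"
proof -
  have "(5 - 2 * real (n + 8)) * pi / 8 = (5 - 2 * real n) * pi / 8 - 2 * pi"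
    by (simp add: field_simps)
  then show ?thesis
    unfolding vert_def by (simp only: flip: cis_divide) simp
qed

lemma vert_add_4 [simp]: "vert (n + 4) = - vert n"
proof -
  have "(5 - 2 * real (n + 4)) * pi / 8 = (5 - 2 * real n) * pi / 8 - pi"
    by (simp add: field_simps)
  then show ?thesis
    unfolding vert_def by (simp only: flip: cis_divide) simp
qed

lemma vert_mod [simp]: "vert (n mod 8) = vert n"
proof -
  have "vert (a + 8 * k) = vert a" for a k
    using vert_add_8[of "a + 8 * _"] by (induction k) (simp_all add: ac_simps)
  then show ?thesis
    by (metis mod_mult_div_eq)
qed

lemma F_mod [simp]: "F (n mod 8) = F n"
  by (simp add: F_eq fun_eq_iff)

lemma F_cong_mod: "i mod 8 = j mod 8 \<Longrightarrow> F i = F j"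
  by (metis F_mod)

lemma vert_cong_mod: "i mod 8 = j mod 8 \<Longrightarrow> vert i = vert j"
  by (metis vert_mod)

lemma V0_eq: "V0 = range vert"
proof -
  have "range vert \<subseteq> vert ` {0..7}"
  proof clarify
    fix n :: nat
    have "n mod 8 < 8" by simp
    then have "n mod 8 \<in> {0..7}" by simp
    then show "vert n \<in> vert ` {0..7}" by (metis imageI vert_mod)
  qed
  then show ?thesis
    by (auto simp: V0_def vert_def cis.code)
qed

lemma vert_in_P: "vert n \<in> P"
  by (simp add: P_def V0_eq hull_inc)

lemma finite_V0: "finite V0"
  by (simp add: V0_def)

lemma compact_P: "compact P"
  by (simp add: P_def finite_V0 compact_convex_hull finite_imp_compact)

lemma convex_P: "convex P"
  by (simp add: P_def)

section \<open>Index offsets modulo 8 and rotations of the octagon\<close>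

lemma ex_offset:
  fixes n k :: nat
  obtains d where "d < 8" "k mod 8 = (n + d) mod 8"
proof
  \<comment> \<open>Since 7 is -1 modulo 8, \<open>k + 7 * n\<close> represents \<open>k - n\<close>
    without truncated subtraction.\<close>
  show "k mod 8 = (n + (k + 7 * n) mod 8) mod 8"
    using mod_mult_self2[of k 8 n] by (simp add: mod_simps algebra_simps)
qed simp

lemma ex_vert_offset:
  obtains d where "d < 8" "vert k = vert (n + d)"
  using ex_offset[of k n] vert_cong_mod by metis

lemma less_8_cases:
  fixes d :: nat
  assumes "d < 8"
  shows "d \<in> {0, 1, 2, 3, 4, 5, 6, 7}"
  using assms by auto

text \<open>The vertices are numbered clockwise, so raising an index by \<open>d\<close> is
  multiplication by this clockwise rotation through \<open>d\<close> times 45 degrees. Inner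
  products of vertices then depend on index differences only.\<close>

definition rot :: "nat \<Rightarrow> complex" where
  "rot d = cis (- (real d * pi / 4))"

lemma vert_add: "vert (n + d) = vert n * rot d"
proof -
  have "(5 - 2 * real (n + d)) * pi / 8 = (5 - 2 * real n) * pi / 8 + - (real d * pi / 4)"
    by (simp add: field_simps)
  then show ?thesis
    by (simp only: vert_def rot_def cis_mult)
qed

lemma rot_add: "rot (a + b) = rot a * rot b"
  by (simp add: rot_def cis_mult add_divide_distrib distrib_right)

lemma rot_table:
  shows "rot 0 = 1" "rot 1 = Complex (sqrt 2 / 2) (- sqrt 2 / 2)" "rot 2 = Complex 0 (- 1)"
    "rot 3 = Complex (- sqrt 2 / 2) (- sqrt 2 / 2)" "rot 4 = - 1"
    "rot 5 = Complex (- sqrt 2 / 2) (sqrt 2 / 2)" "rot 6 = Complex 0 1"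
    "rot 7 = Complex (sqrt 2 / 2) (sqrt 2 / 2)" "rot 8 = 1"
    "rot 9 = Complex (sqrt 2 / 2) (- sqrt 2 / 2)"
proof -
  show 0: "rot 0 = 1" and 1: "rot 1 = Complex (sqrt 2 / 2) (- sqrt 2 / 2)"
    and 2: "rot 2 = Complex 0 (- 1)"
    by (simp_all add: rot_def complex_eq_iff cos_45 sin_45)
  show 3: "rot 3 = Complex (- sqrt 2 / 2) (- sqrt 2 / 2)"
    using rot_add[of 1 2] unfolding 1 2 by (simp add: complex_eq_iff numeral_3_eq_3)
  show 4: "rot 4 = - 1"
    using rot_add[of 2 2] unfolding 2 by (simp add: complex_eq_iff)
  show "rot 5 = Complex (- sqrt 2 / 2) (sqrt 2 / 2)"
    using rot_add[of 4 1] unfolding 1 4 by (simp add: complex_eq_iff)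
  show "rot 6 = Complex 0 1"
    using rot_add[of 4 2] unfolding 2 4 by (simp add: complex_eq_iff)
  show "rot 7 = Complex (sqrt 2 / 2) (sqrt 2 / 2)"
    using rot_add[of 4 3] unfolding 3 4 by (simp add: complex_eq_iff)
  show 8: "rot 8 = 1"
    using rot_add[of 4 4] unfolding 4 by (simp add: complex_eq_iff)
  show "rot 9 = Complex (sqrt 2 / 2) (- sqrt 2 / 2)"
    using rot_add[of 8 1] unfolding 1 8 by (simp add: complex_eq_iff)
qed

lemma norm_vert [simp]: "norm (vert n) = 1"
  by (simp add: vert_def)

lemma inner_vert_mult [simp]: "(vert n * a) \<bullet> (vert n * b) = a \<bullet> b"
proof -
  have "(vert n * a) \<bullet> (vert n * b) = ((Re (vert n))\<^sup>2 + (Im (vert n))\<^sup>2) * (a \<bullet> b)"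
    by (simp add: inner_complex_def power2_eq_square algebra_simps)
  then show ?thesis
    by (simp flip: cmod_power2)
qed

lemma inner_vert_offset [simp]: "vert (n + a) \<bullet> vert (n + b) = rot a \<bullet> rot b"
  by (simp add: vert_add)

text \<open>Up to a factor, \<open>vert n + vert (n + 1)\<close> is the outer normal of the edge from
  \<open>vert n\<close> to \<open>vert (n + 1)\<close>.\<close>

definition normal :: "nat \<Rightarrow> complex" where
  "normal n = vert n + vert (n + 1)"

lemma inner_normal_vert:
  "normal (n + a) \<bullet> vert (n + b) = rot a \<bullet> rot b + rot (a + 1) \<bullet> rot b"
  using inner_vert_offset[of n "a + 1" b] by (simp add: normal_def inner_add_left add.assoc)

text \<open>The bound is 1 + cos 45 degrees. By rotation only the offset of \<open>k\<close> from
  \<open>n\<close> matters, which leaves eight values to read off \<open>rot_table\<close>.\<close>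

lemma normal_le: "normal n \<bullet> vert k \<le> 1 + sqrt 2 / 2"
  and normal_eq: "normal n \<bullet> vert n = 1 + sqrt 2 / 2" "normal n \<bullet> vert (n + 1) = 1 + sqrt 2 / 2"
  and normal_less: "vert k \<noteq> vert n \<Longrightarrow> vert k \<noteq> vert (n + 1) \<Longrightarrow> normal n \<bullet> vert k < 1 + sqrt 2 / 2"
proof -
  have *: "normal n \<bullet> vert (n + d) = rot 0 \<bullet> rot d + rot 1 \<bullet> rot d" for d
    using inner_normal_vert[of n 0 d] by simp
  show "normal n \<bullet> vert n = 1 + sqrt 2 / 2" "normal n \<bullet> vert (n + 1) = 1 + sqrt 2 / 2"
    using *[of 0] *[of 1] by (simp_all add: rot_table rot_table[simplified] inner_complex_def)
  obtain d where d: "d < 8" "vert k = vert (n + d)"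
    using ex_vert_offset by metis
  show "normal n \<bullet> vert k \<le> 1 + sqrt 2 / 2"
    unfolding d(2) * using less_8_cases[OF d(1)] sqrt_2_bounds
    by (auto simp: rot_table rot_table[simplified] inner_complex_def)
  show "normal n \<bullet> vert k < 1 + sqrt 2 / 2" if "vert k \<noteq> vert n" "vert k \<noteq> vert (n + 1)"
    using that less_8_cases[OF d(1)] sqrt_2_bounds
    unfolding d(2) * by (auto simp: rot_table rot_table[simplified] inner_complex_def add_pos_pos)
qed

section \<open>Half-plane bounds for the octagon and its eight images\<close>

lemma P_halfspace:
  assumes "\<And>k. a \<le> u \<bullet> vert k" "x \<in> P"
  shows "a \<le> u \<bullet> x"
proof -
  have "P \<subseteq> {x. u \<bullet> x \<ge> a}"
    unfolding P_def by (rule hull_minimal) (use assms(1) in \<open>auto simp: V0_eq convex_halfspace_ge\<close>)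
  then show ?thesis
    using assms(2) by auto
qed

lemma F_P_halfspace:
  assumes "\<And>k. a \<le> u \<bullet> F n (vert k)" "x \<in> F n ` P"
  shows "a \<le> u \<bullet> x"
proof -
  obtain y where y: "y \<in> P" "x = F n y"
    using assms(2) by auto
  have "(a - (1 - rho) * (u \<bullet> vert n)) \<le> (rho *\<^sub>R u) \<bullet> vert k" for k
    using assms(1)[of k] by (simp add: F_eq inner_add_right)
  from P_halfspace[OF this y(1)] show ?thesis
    by (simp add: y(2) F_eq inner_add_right)
qed

lemma uminus_P: "uminus ` P = P"
proof -
  have neg: "- x \<in> V0" if x: "x \<in> V0" for x
  proof -
    obtain n where "x = vert n"
      using x by (auto simp: V0_eq)
    then have "- x = vert (n + 4)"
      by simp
    then show ?thesis
      unfolding V0_eq by (simp only: rangeI)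
  qed
  have "uminus ` V0 = V0"
  proof
    show "V0 \<subseteq> uminus ` V0"
    proof
      show "x \<in> V0 \<Longrightarrow> x \<in> uminus ` V0" for x
        using neg[of x] by (intro image_eqI[of x uminus "- x"]) simp_all
    qed
  qed (use neg in auto)
  then show ?thesis
    unfolding P_def using convex_hull_linear_image[of "uminus :: complex \<Rightarrow> complex" V0]
    by (simp add: linear_iff)
qed

lemma F_vert_self [simp]: "F n (vert n) = vert n"
  by (simp add: F_eq flip: scaleR_left_distrib)

text \<open>\<open>F n z\<close> is a convex combination of \<open>z\<close> and
  \<open>vert n\<close>.\<close>

lemma F_convex:
  assumes "convex S" "vert n \<in> S"
  shows "F n ` S \<subseteq> S"
  using assms rho_pos rho_less_half by (auto simp: F_eq intro!: convexD)

lemma F_P: "F n ` P \<subseteq> P"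
  by (simp add: F_convex convex_P vert_in_P)

text \<open>The bound is the least value of \<open>normal (n + d)\<close> on the octagons
  \<open>n + d\<close> and \<open>n + d + 1\<close>. It fails for \<open>d = 7\<close>, where the
  left side is larger by \<open>rho\<close>.\<close>

lemma hole_ray_aux:
  assumes "d < 7"
  shows "normal (n + d) \<bullet> F n (vert (n + 5)) \<le> (1 - 2 * rho) * (1 + sqrt 2 / 2)"
proof -
  have "normal (n + d) \<bullet> F n (vert (n + 5)) =
      rho * (rot d \<bullet> rot 5 + rot (d + 1) \<bullet> rot 5) + (1 - rho) * (rot d \<bullet> rot 0 + rot (d + 1) \<bullet> rot 0)"
    using inner_normal_vert[of n d 5] inner_normal_vert[of n d 0]
    by (simp add: F_eq inner_add_right)
  also have "\<dots> \<le> (1 - 2 * rho) * (1 + sqrt 2 / 2)"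
    using less_8_cases[of d] assms sqrt_2_bounds
    by (auto simp: numeral_2_eq_2[symmetric] rot_table rot_table[simplified] inner_complex_def rho_eq
        algebra_simps) (simp_all add: field_simps)
  finally show ?thesis .
qed

text \<open>The segment is an inner edge of octagon \<open>n\<close>. For every \<open>j\<close>
  some line along an inner edge of octagon \<open>j\<close> keeps the half-open ray from 0 to
  \<open>z\<close> strictly on the side of 0, so this ray avoids the whole ring.\<close>

lemma hole_ray:
  assumes z: "z \<in> F n ` closed_segment (vert (n + 4)) (vert (n + 5))" and t: "0 \<le> t" "t < 1"
  shows "t *\<^sub>R z \<notin> F j ` P"
proof
  assume in_j: "t *\<^sub>R z \<in> F j ` P"
  define h where "h = (1 - 2 * rho) * (1 + sqrt 2 / 2)"
  have h: "0 < h"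
    using rho_less_half by (simp add: h_def add_pos_pos)
  obtain d where d: "d < 8" "j mod 8 = (n + d) mod 8"
    using ex_offset by metis
  then have j: "F j = F (n + d)" "vert j = vert (n + d)"
    using F_cong_mod vert_cong_mod by metis+
  \<comment> \<open>Both inner edges of octagon \<open>j\<close> separate it from the centre; the one normal to the
    direction of \<open>F n (vert (n + 5))\<close> does not separate it from that point and is avoided.\<close>
  define c where "c = (if d = 7 then 6 else d)"
  have c: "c < 7" "normal (n + c) \<bullet> vert j = 1 + sqrt 2 / 2"
    using d(1) normal_eq(1)[of "n + d"] normal_eq(2)[of "n + 6"] by (auto simp: c_def j add.commute)
  \<comment> \<open>As \<open>vert (k + 4)\<close> is \<open>- vert k\<close>, the upper bound at
    the antipodal vertex is a lower bound at \<open>vert k\<close>.\<close>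
  have lower: "h \<le> normal (n + c) \<bullet> F j (vert k)" for k
  proof -
    have "rho * (normal (n + c) \<bullet> vert (k + 4)) \<le> rho * (1 + sqrt 2 / 2)"
      using rho_pos by (intro mult_left_mono normal_le) auto
    moreover have "normal (n + c) \<bullet> F j (vert k) =
        rho * (normal (n + c) \<bullet> vert k) + (1 - rho) * (1 + sqrt 2 / 2)"
      by (simp only: F_eq inner_add_right inner_scaleR_right c(2))
    ultimately show ?thesis
      by (simp add: h_def field_simps)
  qed
  have "(1 - 2 * rho) * (normal (n + c) \<bullet> vert n) \<le> h"
    unfolding h_def using rho_less_half by (intro mult_left_mono normal_le) auto
  moreover have "normal (n + c) \<bullet> F n (vert (n + 4)) = (1 - 2 * rho) * (normal (n + c) \<bullet> vert n)"
    by (simp only: F_eq vert_add_4 inner_add_right inner_scaleR_right inner_minus_right)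
      (simp add: left_diff_distrib)
  ultimately have upper4: "normal (n + c) \<bullet> F n (vert (n + 4)) \<le> h"
    by simp
  have upper5: "normal (n + c) \<bullet> F n (vert (n + 5)) \<le> h"
    unfolding h_def using c(1) by (rule hole_ray_aux)
  obtain y where y: "y \<in> closed_segment (vert (n + 4)) (vert (n + 5))" "z = F n y"
    using z by auto
  then obtain a where a: "0 \<le> a" "a \<le> 1" "y = (1 - a) *\<^sub>R vert (n + 4) + a *\<^sub>R vert (n + 5)"
    by (auto simp: in_segment)
  have "z = (1 - a) *\<^sub>R F n (vert (n + 4)) + a *\<^sub>R F n (vert (n + 5))"
    unfolding y(2) a(3) F_eq by (simp add: algebra_simps)
  then have "normal (n + c) \<bullet> z \<le> (1 - a) * h + a * h"
    using a upper4 upper5 by (simp only: inner_add_right inner_scaleR_right) (intro add_mono mult_left_mono; simp)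
  then have "t * (normal (n + c) \<bullet> z) \<le> t * h"
    using t by (intro mult_left_mono) (simp_all add: algebra_simps)
  also have "\<dots> < h"
    using t h by simp
  finally have "normal (n + c) \<bullet> (t *\<^sub>R z) < h"
    by simp
  moreover have "h \<le> normal (n + c) \<bullet> (t *\<^sub>R z)"
    using lower in_j by (rule F_P_halfspace)
  ultimately show False
    by simp
qed

text \<open>The perpendicular bisector of two vertices passes through 0, and octagon
  \<open>n\<close> stays on the side of \<open>vert n\<close>. By rotation only finitely many index
  differences have to be checked.\<close>

lemma F_vert_separated:
  assumes "d < 8" "e < 8"
  shows "0 \<le> (vert n - vert (n + d)) \<bullet> F n (vert (n + e))"
proof -
  have "(vert n - vert (n + d)) \<bullet> F n (vert (n + e)) =
      rho * (rot 0 \<bullet> rot e - rot d \<bullet> rot e) + (1 - rho) * (rot 0 \<bullet> rot 0 - rot d \<bullet> rot 0)"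
    using inner_vert_offset[of n 0 e] inner_vert_offset[of n d e] inner_vert_offset[of n 0 0]
      inner_vert_offset[of n d 0]
    by (simp add: F_eq inner_add_right inner_diff_left del: inner_vert_offset)
  also have "\<dots> \<ge> 0"
    using less_8_cases[OF assms(1)] less_8_cases[OF assms(2)] sqrt_2_bounds
    by (auto simp: rot_table rot_table[simplified] inner_complex_def rho_eq field_simps)
  finally show ?thesis .
qed

lemma F_P_separated:
  assumes "x \<in> F i ` P"
  shows "0 \<le> (vert i - vert j) \<bullet> x"
proof (rule F_P_halfspace[OF _ assms])
  fix k
  obtain d e where "d < 8" "vert j = vert (i + d)" "e < 8" "vert k = vert (i + e)"
    using ex_vert_offset by metis
  then show "0 \<le> (vert i - vert j) \<bullet> F i (vert k)"
    using F_vert_separated by simp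
qed

lemma interior_F_P_disjoint:
  assumes "vert i \<noteq> vert j"
  shows "interior (F i ` P) \<inter> F j ` P = {}"
proof -
  have "interior (F i ` P) \<subseteq> interior {x. (vert i - vert j) \<bullet> x \<ge> 0}"
    using F_P_separated by (intro interior_mono) auto
  also have "\<dots> = {x. (vert i - vert j) \<bullet> x > 0}"
    using assms by (intro interior_halfspace_ge) simp
  finally have "x \<in> interior (F i ` P) \<Longrightarrow> (vert i - vert j) \<bullet> x > 0" for x
    by blast
  moreover have "x \<in> F j ` P \<Longrightarrow> (vert j - vert i) \<bullet> x \<ge> 0" for x
    by (rule F_P_separated)
  ultimately show ?thesis
    by (fastforce simp: inner_diff_left)
qed

text \<open>The line through the two vertices supports the octagon: all other vertices lie strictly
  on its inner side, so the hull of the two is a face, of dimension 1.\<close>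

lemma edge_of_P: "closed_segment (vert n) (vert (n + 1)) edge_of P"
proof -
  let ?T = "{vert n, vert (n + 1)}" and ?c = "1 + sqrt 2 / 2"
  have "affine hull ?T \<subseteq> {x. normal n \<bullet> x = ?c}"
    by (rule hull_minimal) (simp_all add: normal_eq[simplified] affine_hyperplane)
  moreover have "convex hull (V0 - ?T) \<subseteq> {x. normal n \<bullet> x < ?c}"
    by (rule hull_minimal) (auto simp: V0_eq intro!: normal_less convex_halfspace_lt)
  ultimately have "affine hull ?T \<inter> convex hull (V0 - ?T) = {}"
    by force
  then have "convex hull ?T face_of P"
    unfolding P_def by (intro face_of_convex_hulls finite_V0) (auto simp: V0_eq)
  moreover have "vert n \<noteq> vert (n + 1)"
    using inner_vert_offset[of n 0 0] inner_vert_offset[of n 0 1] sqrt_2_bounds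
    by (auto simp: rot_table rot_table[simplified] inner_complex_def)
  then have "aff_dim (convex hull ?T) = 1"
    by (simp add: aff_dim_convex_hull aff_dim_2)
  ultimately show ?thesis
    by (simp add: edge_of_def segment_convex_hull)
qed

lemma edge_of_affine_image:
  fixes S :: "'a::euclidean_space set"
  assumes "e edge_of S" "r \<noteq> 0"
  shows "(\<lambda>z. r *\<^sub>R z + a) ` e edge_of (\<lambda>z. r *\<^sub>R z + a) ` S"
proof -
  have *: "(\<lambda>z. r *\<^sub>R z + a) ` A = (+) a ` ((*\<^sub>R) r ` A)" for A :: "'a set"
    by (auto simp: image_image add.commute)
  have "inj ((*\<^sub>R) r :: 'a \<Rightarrow> 'a)" "linear ((*\<^sub>R) r :: 'a \<Rightarrow> 'a)"
    using assms(2) by (simp_all add: inj_on_def linear_scaleR)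
  then show ?thesis
    using assms(1)
    by (simp add: * edge_of_def face_of_translation_eq face_of_linear_image aff_dim_translation_eq
        aff_dim_injective_linear_image)
qed

section \<open>Cells of higher level\<close>

text \<open>The translation part \<open>foldr F w 0\<close> is the centre of the cell, about which
  its central hole will be symmetric.\<close>

lemma foldr_F_affine: "foldr F w z = rho ^ length w *\<^sub>R z + foldr F w 0"
proof (induction w)
  case (Cons n w)
  have "foldr F (n # w) z = F n (rho ^ length w *\<^sub>R z + foldr F w 0)"
    using Cons.IH by simp
  also have "\<dots> = (rho * rho ^ length w) *\<^sub>R z + F n (foldr F w 0)"
    unfolding F_eq by (simp add: scaleR_add_right)
  finally show ?case
    by simp
qed simp

lemma foldr_F_mod: "foldr F (map (\<lambda>n. n mod 8) w) = foldr F w"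
  by (induction w) simp_all

lemma foldr_F_replicate: "foldr F (replicate k q) z = rho ^ k *\<^sub>R z + (1 - rho ^ k) *\<^sub>R vert q"
proof (induction k)
  case (Suc k)
  have "foldr F (replicate (Suc k) q) z = F q (rho ^ k *\<^sub>R z + (1 - rho ^ k) *\<^sub>R vert q)"
    using Suc.IH by simp
  also have "\<dots> = (rho * rho ^ k) *\<^sub>R z + (1 - rho * rho ^ k) *\<^sub>R vert q"
    unfolding F_eq by (simp add: algebra_simps)
  finally show ?case
    by simp
qed simp

lemma continuous_on_foldr_F: "continuous_on S (foldr F w)"
proof -
  have "continuous_on S (\<lambda>z. rho ^ length w *\<^sub>R z + foldr F w 0)"
    by (intro continuous_intros)
  then show ?thesis
    by (simp flip: foldr_F_affine)
qed

lemma Pw_in_cells: "length w = m \<Longrightarrow> Pw w \<in> cells m"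
proof -
  assume "length w = m"
  then have "length (map (\<lambda>n. n mod 8) w) = m" "set (map (\<lambda>n. n mod 8) w) \<subseteq> {0..7}"
    by (auto simp: less_Suc_eq_le[of _ 7, simplified])
  moreover have "Pw w = Pw (map (\<lambda>n. n mod 8) w)"
    by (simp only: Pw_def foldr_F_mod)
  ultimately show ?thesis
    unfolding cells_def by blast
qed

lemma cells_eq: "cells m = Pw ` {w. length w = m}"
  using Pw_in_cells by (auto simp: cells_def)

lemma Om_eq: "Om m = (\<Union>w\<in>{w. length w = m}. foldr F w ` P)"
  by (simp add: Om_def cells_eq Pw_def)

lemma Om_0 [simp]: "Om 0 = P"
  by (simp add: Om_eq)

lemma Om_add: "Om (l + k) = (\<Union>w\<in>{w. length w = l}. foldr F w ` Om k)"
proof -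
  have "{w :: nat list. length w = l + k} = {u @ v |u v. length u = l \<and> length v = k}"
  proof (intro equalityI subsetI; clarsimp)
    fix w :: "nat list"
    assume "length w = l + k"
    then show "\<exists>u v. w = u @ v \<and> length u = l \<and> length v = k"
      by (intro exI[of _ "take l w"] exI[of _ "drop l w"]) simp
  qed
  then show ?thesis
    by (fastforce simp: Om_eq image_UN image_image)
qed

lemma Om_Suc: "Om (Suc k) = (\<Union>n. F n ` Om k)"
proof -
  have "Om (1 + k) = (\<Union>n. F n ` Om k)"
    unfolding Om_add by (fastforce simp: length_Suc_conv)
  then show ?thesis
    by simp
qed

lemma Om_subset_P: "Om k \<subseteq> P"
  by (induction k) (use F_P in \<open>fastforce simp: Om_Suc\<close>)+

lemma compact_Om: "compact (Om m)"
proof -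
  have "cells m = Pw ` {w. set w \<subseteq> {0..7} \<and> length w = m}"
    by (auto simp: cells_def)
  then have "finite (cells m)"
    by (simp add: finite_lists_length_eq)
  moreover have "compact A" if "A \<in> cells m" for A
    using that compact_continuous_image[OF continuous_on_foldr_F compact_P]
    by (auto simp: cells_def Pw_def)
  ultimately show ?thesis
    unfolding Om_def by (rule compact_Union)
qed

lemma uminus_F: "- F n x = F (n + 4) (- x)"
  by (simp add: F_eq)

lemma uminus_in_Om: "x \<in> Om k \<Longrightarrow> - x \<in> Om k"
proof (induction k arbitrary: x)
  case 0
  then show ?case using uminus_P by auto
next
  case (Suc k)
  then show ?case
    by (force simp: Om_Suc uminus_F)
qed

section \<open>Disjointness of cell interiors\<close>

lemma interior_affine_image:
  fixes S :: "'a::euclidean_space set"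
  assumes "r \<noteq> 0"
  shows "interior ((\<lambda>z. r *\<^sub>R z + a) ` S) = (\<lambda>z. r *\<^sub>R z + a) ` interior S"
proof -
  have *: "(\<lambda>z. r *\<^sub>R z + a) ` A = (+) a ` ((*\<^sub>R) r ` A)" for A :: "'a set"
    by (auto simp: image_image add.commute)
  have "inj ((*\<^sub>R) r :: 'a \<Rightarrow> 'a)" "linear ((*\<^sub>R) r :: 'a \<Rightarrow> 'a)"
    using assms by (simp_all add: inj_on_def linear_scaleR)
  then show ?thesis
    by (simp add: * interior_translation interior_injective_linear_image)
qed

lemma interior_F: "interior (F n ` S) = F n ` interior S"
  using interior_affine_image[of rho "(1 - rho) *\<^sub>R vert n" S] rho_pos
  by (simp add: F_eq[abs_def])

lemma inj_F: "inj (F n)"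
  using rho_pos by (simp add: inj_on_def F_eq)

lemma foldr_F_P: "foldr F w ` P \<subseteq> P"
proof (induction w)
  case (Cons n w)
  have "foldr F (n # w) ` P = F n ` (foldr F w ` P)"
    by (simp add: image_image)
  then show ?case
    using Cons.IH F_P by blast
qed simp

text \<open>At the first position where the letters give different contractions, a bisector
  separates the two octagons; the common letters before it act injectively and preserve interiors.
  Maps are compared instead of words because letters count only modulo 8.\<close>

lemma interior_foldr_F_disjoint:
  assumes "length w = length w'" "foldr F w \<noteq> foldr F w'"
  shows "interior (foldr F w ` P) \<inter> foldr F w' ` P = {}"
  using assms
proof (induction w w' rule: list_induct2)
  case (Cons i w j w')
  have eq: "foldr F (n # v) ` P = F n ` (foldr F v ` P)" for n v
    by (simp add: image_image)
  show ?case
  proof (cases "vert i = vert j")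
    case True
    then have "F i = F j"
      by (simp add: F_eq fun_eq_iff)
    then have "foldr F w \<noteq> foldr F w'"
      using Cons.prems by auto
    then show ?thesis
      using Cons.IH image_Int[OF inj_F, of j "interior (foldr F w ` P)" "foldr F w' ` P"]
      unfolding eq interior_F \<open>F i = F j\<close> by simp
  next
    case False
    have "interior (foldr F (i # w) ` P) \<subseteq> interior (F i ` P)"
      unfolding eq by (intro interior_mono image_mono foldr_F_P)
    moreover have "foldr F (j # w') ` P \<subseteq> F j ` P"
      unfolding eq by (intro image_mono foldr_F_P)
    ultimately show ?thesis
      using interior_F_P_disjoint[OF False] by blast
  qed
qed simp

section \<open>Central holes\<close>

lemma zero_notin_F_P: "0 \<notin> F j ` P"
  using hole_ray[of "F 0 (vert 4)" 0 0 j] by simp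

lemma zero_notin_Om_Suc: "0 \<notin> Om (Suc k)"
  using zero_notin_F_P Om_subset_P by (fastforce simp: Om_Suc)

section \<open>A closed path around the centre\<close>

lemma path_component_F:
  assumes "path_component S x y"
  shows "path_component (F n ` S) (F n x) (F n y)"
proof -
  obtain g where g: "path g" "path_image g \<subseteq> S" "pathstart g = x" "pathfinish g = y"
    using assms unfolding path_component_def by auto
  have "path (F n \<circ> g)"
    using g(1) by (intro path_continuous_image) (simp_all add: F_eq[abs_def] continuous_intros)
  then show ?thesis
    unfolding path_component_def using g
    by (intro exI[of _ "F n \<circ> g"]) (auto simp: path_image_compose pathstart_compose pathfinish_compose)
qed

text \<open>After \<open>vert n\<close> is factored out, this is an identity between entries of
  \<open>rot_table\<close>; the value of \<open>rho\<close> is the one for which consecutive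
  octagons of the ring touch.\<close>

lemma F_shared_vertex: "F (n + 1) (vert (n + 7)) = F n (vert (n + 2))"
proof -
  have "vert n * (rho *\<^sub>R rot 7 + (1 - rho) *\<^sub>R rot 1) = vert n * (rho *\<^sub>R rot 2 + (1 - rho) *\<^sub>R rot 0)"
    by (rule arg_cong[of _ _ "(*) (vert n)"])
      (simp add: rot_table rot_table[simplified] rho_eq complex_eq_iff field_simps)
  then show ?thesis
    using vert_add[of n 0] by (simp add: F_eq vert_add[of n 7] vert_add[of n 1, simplified]
        vert_add[of n 2, simplified] algebra_simps rot_table)
qed

text \<open>By induction the vertices of each subcell are joined inside it, and a shared vertex
  leads from subcell \<open>n\<close> to subcell \<open>n + 1\<close>.\<close>

lemma path_component_Om_vert: "path_component (Om k) (vert a) (vert b)"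
proof (induction k arbitrary: a b)
  case 0
  then show ?case
    using convex_imp_path_connected[OF convex_P] vert_in_P by (simp add: path_connected_component)
next
  case (Suc k)
  have F: "path_component (Om (Suc k)) (F n (vert i)) (F n (vert j))" for n i j
    using path_component_F[OF Suc.IH] path_component_of_subset by (metis Om_Suc UN_upper UNIV_I)
  have step: "path_component (Om (Suc k)) (vert n) (vert (n + 1))" for n
    using F[of n n "n + 2"] F[of "n + 1" "n + 7" "n + 1"]
    unfolding F_vert_self F_shared_vertex by (rule path_component_trans)
  have "path_component (Om (Suc k)) (vert a) (vert (a + d))" for d
  proof (induction d)
    case 0
    then show ?case using F[of a a a] by simp
  next
    case (Suc d)
    then show ?case using step[of "a + d"] by (auto intro: path_component_trans)
  qed
  then show ?case
    using ex_vert_offset[of b a] by metis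
qed

text \<open>The chord runs from the vertex shared with octagon \<open>n + 1\<close> to the one
  shared with octagon \<open>n + 7\<close>, hence counterclockwise around 0; this is the sign
  criterion for a positive winding number.\<close>

lemma F_arc_Im_pos:
  fixes n :: nat
  defines "a \<equiv> F n (vert (n + 2))" and "b \<equiv> F n (vert (n + 6))"
  shows "0 < Im ((b - a) * cnj (b - 0))"
proof -
  have v: "(Re (vert n))\<^sup>2 + (Im (vert n))\<^sup>2 = 1"
    using cmod_power2[of "vert n"] by simp
  have ab: "a = (1 - rho) *\<^sub>R vert n - (rho *\<^sub>R \<i>) * vert n" "b = (1 - rho) *\<^sub>R vert n + (rho *\<^sub>R \<i>) * vert n"
    unfolding a_def b_def F_eq vert_add[of n 2] vert_add[of n 6] rot_table
    by (simp_all add: complex_eq_iff)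
  have "Im ((b - a) * cnj (b - 0)) =
      2 * rho * (1 - rho) * ((Re (vert n))\<^sup>2 + (Im (vert n))\<^sup>2)"
    unfolding ab by (simp add: power2_eq_square algebra_simps)
  then show ?thesis
    using rho_pos rho_less_half v by simp
qed

text \<open>A path through the subcell may wander, but it stays in a convex octagon that misses 0,
  so it is homotopic to the chord in the punctured plane.\<close>

lemma F_arc:
  obtains g where "path g" "path_image g \<subseteq> Om (Suc k)" "pathstart g = F n (vert (n + 2))"
    "pathfinish g = F n (vert (n + 6))" "0 < Re (winding_number g 0)"
proof -
  let ?a = "F n (vert (n + 2))" and ?b = "F n (vert (n + 6))"
  obtain g where g: "path g" "path_image g \<subseteq> F n ` Om k" "pathstart g = ?a" "pathfinish g = ?b"
    using path_component_F[OF path_component_Om_vert] unfolding path_component_def by blast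
  have "convex (F n ` P)"
    using convex_affinity[OF convex_P, of "(1 - rho) *\<^sub>R vert n" rho]
    by (simp add: F_eq[abs_def] add.commute)
  then have conv: "closed_segment x y \<subseteq> - {0}" if "x \<in> F n ` P" "y \<in> F n ` P" for x y
    using closed_segment_subset[OF that] zero_notin_F_P[of n] by auto
  have "F n ` Om k \<subseteq> F n ` P"
    using Om_subset_P by (rule image_mono)
  have "homotopic_paths (- {0}) g (linepath ?a ?b)"
  proof (rule homotopic_paths_linear)
    fix t :: real
    assume "t \<in> {0..1}"
    then have "g t \<in> F n ` P" "linepath ?a ?b t \<in> closed_segment ?a ?b"
      using subset_trans[OF g(2) \<open>F n ` Om k \<subseteq> F n ` P\<close>]
      by (simp_all add: path_image_def image_subset_iff linepath_in_path)
    moreover have "closed_segment ?a ?b \<subseteq> F n ` P"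
      using \<open>convex (F n ` P)\<close> by (intro closed_segment_subset) (auto intro: vert_in_P)
    ultimately show "closed_segment (g t) (linepath ?a ?b t) \<subseteq> - {0}"
      by (intro conv) auto
  qed (use g in simp_all)
  then have "winding_number g 0 = winding_number (linepath ?a ?b) 0"
    by (rule winding_number_homotopic_paths)
  also have "0 < Re \<dots>"
    using F_arc_Im_pos by (rule winding_number_linepath_pos_lt)
  finally have "0 < Re (winding_number g 0)" .
  moreover have "path_image g \<subseteq> Om (Suc k)"
    unfolding Om_Suc using g(2) by blast
  ultimately show thesis
    using that[OF g(1) _ g(3,4)] by blast
qed

lemma bounded_central_hole: "bounded (connected_component_set (- Om (Suc k)) 0)"
proof -
  \<comment> \<open>The factor 7 is -1 modulo 8: the octagons are visited in decreasing order, and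
    arc \<open>i\<close> runs through octagon \<open>7 * i\<close> from \<open>r i\<close> to
    \<open>r (Suc i)\<close>.\<close>
  define r where "r i = F (7 * i) (vert (7 * i + 2))" for i
  have r_Suc: "F (7 * i) (vert (7 * i + 6)) = r (Suc i)" for i
  proof -
    have "7 * i + 7 + 1 = 7 * i + 8" "7 * i + 7 + 7 = 7 * i + 6 + 8"
      by simp_all
    then have "7 * i mod 8 = (7 * i + 7 + 1) mod 8" "(7 * i + 6) mod 8 = (7 * i + 7 + 7) mod 8"
      by (simp_all only: mod_add_self2)
    then have "F (7 * i) (vert (7 * i + 6)) = F (7 * i + 7 + 1) (vert (7 * i + 7 + 7))"
      using F_cong_mod vert_cong_mod by metis
    also have "\<dots> = F (7 * i + 7) (vert (7 * i + 7 + 2))"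
      by (rule F_shared_vertex)
    also have "7 * i + 7 = 7 * Suc i"
      by simp
    finally show ?thesis
      unfolding r_def .
  qed
  have "\<exists>g. path g \<and> path_image g \<subseteq> Om (Suc k) \<and> pathstart g = r 0 \<and> pathfinish g = r (Suc i) \<and>
      0 < Re (winding_number g 0)" for i
  proof (induction i)
    case 0
    show ?case
      using F_arc[of k "7 * 0"] unfolding r_Suc r_def[of 0, symmetric] by metis
  next
    case (Suc i)
    then obtain g where g: "path g" "path_image g \<subseteq> Om (Suc k)" "pathstart g = r 0"
        "pathfinish g = r (Suc i)" "0 < Re (winding_number g 0)"
      by blast
    obtain g' where g': "path g'" "path_image g' \<subseteq> Om (Suc k)" "pathstart g' = r (Suc i)"
        "pathfinish g' = r (Suc (Suc i))" "0 < Re (winding_number g' 0)"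
      using F_arc[of k "7 * Suc i"] unfolding r_Suc r_def[of "Suc i", symmetric] by metis
    have "winding_number (g +++ g') 0 = winding_number g 0 + winding_number g' 0"
      using g g' zero_notin_Om_Suc by (intro winding_number_join) auto
    then show ?case
      using g g' by (intro exI[of _ "g +++ g'"]) (auto simp: path_image_join)
  qed
  \<comment> \<open>The claim concerns \<open>i + 1\<close> arcs, so \<open>i = 7\<close> uses all
    eight and ends at \<open>r 8 = r 0\<close>.\<close>
  from this[of 7] obtain g where g: "path g" "path_image g \<subseteq> Om (Suc k)" "pathstart g = r 0"
      "pathfinish g = r 8" "0 < Re (winding_number g 0)"
    by auto
  have "r 8 = r 0"
    using F_cong_mod[of 56 0] vert_cong_mod[of 58 2] by (simp add: r_def numeral_2_eq_2)
  then have "0 \<notin> outside (path_image g)"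
    using winding_number_zero_in_outside[of g 0] g by auto
  then have "0 \<notin> outside (Om (Suc k))"
    using outside_mono[OF g(2)] by blast
  then show ?thesis
    using zero_notin_Om_Suc by (simp add: outside)
qed

text \<open>The point reflection fixes \<open>c\<close>, so it maps the component of
  \<open>c\<close> into itself, and onto itself because it is an involution. For \<open>c\<close>
  outside \<open>S\<close> the component is empty.\<close>

lemma connected_component_symmetric:
  fixes c :: complex
  assumes "\<And>x. x \<in> S \<Longrightarrow> 2 * c - x \<in> S"
  shows "symmetric_about (connected_component_set S c) c"
proof (cases "c \<in> S")
  case True
  let ?H = "connected_component_set S c"
  have "(\<lambda>x. 2 * c - x) ` ?H \<subseteq> ?H"
  proof (rule connected_component_maximal)
    show "c \<in> (\<lambda>x. 2 * c - x) ` ?H"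
      using True by (auto intro!: image_eqI[of _ _ c])
    show "connected ((\<lambda>x. 2 * c - x) ` ?H)"
      by (intro connected_continuous_image continuous_intros connected_connected_component)
    show "(\<lambda>x. 2 * c - x) ` ?H \<subseteq> S"
      using assms connected_component_subset by fastforce
  qed
  moreover from this have "?H \<subseteq> (\<lambda>x. 2 * c - x) ` ?H"
    by (force intro: image_eqI[of _ _ "2 * c - _"])
  ultimately show ?thesis
    by (simp add: symmetric_about_def)
next
  case False
  then have "connected_component_set S c = {}"
    by (simp only: connected_component_eq_empty not_False_eq_True)
  then show ?thesis
    by (simp only: symmetric_about_def image_empty)
qed

text \<open>The last clause is what gluing needs: points of level-\<open>m\<close> cells on the
  inner edges of the ring inside cell \<open>w\<close> lie on the frontier of its hole.\<close>

lemma central_hole: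
  fixes w :: "nat list" and k :: nat
  defines "c \<equiv> foldr F w 0" and "m \<equiv> length w + Suc k"
  obtains H where "H \<in> components (- Om m)" "symmetric_about H c" "bounded H"
    "\<And>n z. z \<in> F n ` closed_segment (vert (n + 4)) (vert (n + 5)) \<Longrightarrow>
      foldr F w z \<in> Om m \<Longrightarrow> foldr F w z \<in> frontier H"
proof
  define r where "r = rho ^ length w"
  have r: "0 < r"
    using rho_pos by (simp add: r_def)
  have f: "foldr F w z = r *\<^sub>R z + c" for z
    unfolding r_def c_def by (rule foldr_F_affine)
  define C where "C = foldr F w ` Om (Suc k)"
  \<comment> \<open>\<open>H\<close> is taken relative to the single copy \<open>C\<close>, where it
    is a scaled image of the hole around 0; that it is also a component for all of
    \<open>Om m\<close> is shown afterwards.\<close>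
  define H where "H = connected_component_set (- C) c"
  have f_inj: "foldr F w x = foldr F w y \<longleftrightarrow> x = y" for x y
    using r by (simp add: f)
  have f_C: "foldr F w z \<in> C \<longleftrightarrow> z \<in> Om (Suc k)" for z
    using f_inj by (auto simp: C_def)
  have c_C: "c \<notin> C"
    using f_C[of 0] zero_notin_Om_Suc by (simp add: c_def)
  have C_sub: "C \<subseteq> foldr F w ` P"
    using Om_subset_P by (auto simp: C_def)
  have C_Om: "C \<subseteq> Om m"
    unfolding C_def m_def Om_add by auto
  have closed_C: "closed C"
    unfolding C_def by (intro compact_imp_closed compact_continuous_image continuous_on_foldr_F compact_Om)
  have open_H: "open H"
    unfolding H_def using closed_C by (intro open_connected_component) (simp add: open_Compl)
  have c_H: "c \<in> H" and H_C: "H \<inter> C = {}" and conn_H: "connected H"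
    using c_C connected_component_subset[of "- C" c] by (auto simp: H_def)
  show sym: "symmetric_about H c"
    unfolding H_def
  proof (rule connected_component_symmetric)
    fix x
    assume x: "x \<in> - C"
    define z where "z = (1 / r) *\<^sub>R (x - c)"
    have x_eq: "x = foldr F w z" "2 * c - x = foldr F w (- z)"
      using r by (simp_all add: f z_def)
    have "- z \<in> Om (Suc k) \<Longrightarrow> z \<in> Om (Suc k)"
      using uminus_in_Om[of "- z"] by simp
    then have "foldr F w (- z) \<notin> C"
      using x unfolding x_eq(1) by (auto simp: f_C)
    then show "2 * c - x \<in> - C"
      unfolding x_eq(2) by simp
  qed
  show bounded_H: "bounded H"
  proof -
    let ?g = "\<lambda>x. (1 / r) *\<^sub>R (x - c)"
    have fg: "foldr F w (?g x) = x" for x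
      using r by (simp add: f)
    have "?g ` H \<subseteq> connected_component_set (- Om (Suc k)) 0"
    proof (rule connected_component_maximal)
      show "0 \<in> ?g ` H"
        using c_H by (auto intro!: image_eqI[of _ _ c])
      show "connected (?g ` H)"
        by (intro connected_continuous_image continuous_intros conn_H)
      show "?g ` H \<subseteq> - Om (Suc k)"
        using H_C by (auto simp flip: f_C simp: fg)
    qed
    then have "bounded (?g ` H)"
      using bounded_central_hole bounded_subset by blast
    then have "bounded ((\<lambda>z. c + r *\<^sub>R z) ` (?g ` H))"
      using bounded_translation bounded_scaling by (metis image_image)
    moreover have "(\<lambda>z. c + r *\<^sub>R z) ` (?g ` H) = H"
      using r by (simp add: image_image)
    ultimately show ?thesis
      by simp
  qed
  have conv: "convex (foldr F w ` P)"
    using convex_affinity[OF convex_P, of c r] by (simp add: f add.commute)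
  \<comment> \<open>A point of \<open>H\<close> beyond the convex cell would lie outside
    \<open>C\<close>, and then its component \<open>H\<close> would be unbounded.\<close>
  have "H \<subseteq> foldr F w ` P"
  proof (intro subsetI, rule ccontr)
    fix x
    assume x: "x \<in> H" and "x \<notin> foldr F w ` P"
    then have "x \<in> outside C"
      using convex_in_outside[OF conv] outside_mono[OF C_sub] by blast
    moreover have "connected_component_set (- C) x = H"
      using x connected_component_eq unfolding H_def by blast
    ultimately show False
      using bounded_H by (simp add: outside)
  qed
  then have H_int: "H \<subseteq> interior (foldr F w ` P)"
    using open_H by (rule interior_maximal)
  have H_Om: "H \<subseteq> - Om m"
  proof (rule ccontr)
    assume "\<not> H \<subseteq> - Om m"
    then obtain x w' where x: "x \<in> H" "length w' = length w" "x \<in> foldr F w' ` Om (Suc k)"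
      unfolding m_def Om_add by auto
    then have "foldr F w' \<noteq> foldr F w"
      using H_C by (auto simp: C_def)
    then have "interior (foldr F w ` P) \<inter> foldr F w' ` P = {}"
      using x(2) by (intro interior_foldr_F_disjoint) auto
    then show False
      using x H_int Om_subset_P by blast
  qed
  have "H = connected_component_set (- Om m) c"
  proof
    show "H \<subseteq> connected_component_set (- Om m) c"
      using c_H conn_H H_Om by (rule connected_component_maximal)
    show "connected_component_set (- Om m) c \<subseteq> H"
      unfolding H_def using C_Om by (intro connected_component_mono) auto
  qed
  then show "H \<in> components (- Om m)"
    using c_H H_Om by (auto simp: components_def)
  fix n z
  assume z: "z \<in> F n ` closed_segment (vert (n + 4)) (vert (n + 5))" "foldr F w z \<in> Om m"
  have ray: "foldr F w (t *\<^sub>R z) \<in> H" if t: "0 \<le> t" "t < 1" for t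
  proof -
    have sub: "(\<lambda>t. foldr F w (t *\<^sub>R z)) ` {0..<1} \<subseteq> H"
      unfolding H_def
    proof (rule connected_component_maximal)
      show "c \<in> (\<lambda>t. foldr F w (t *\<^sub>R z)) ` {0..<1}"
        by (auto simp: f intro!: image_eqI[of _ _ 0])
      show "connected ((\<lambda>t. foldr F w (t *\<^sub>R z)) ` {0..<1})"
        unfolding f by (intro connected_continuous_image continuous_intros) simp
      show "(\<lambda>t. foldr F w (t *\<^sub>R z)) ` {0..<1} \<subseteq> - C"
        using hole_ray[OF z(1)] Om_subset_P by (fastforce simp: f_C Om_Suc)
    qed
    then show ?thesis
      using t by (auto simp: image_subset_iff)
  qed
  \<comment> \<open>As \<open>t\<close> tends to 1, \<open>foldr F w z\<close> turns out to be in
    the closure of \<open>H\<close>; being in \<open>Om m\<close>, it is not in the open set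
    \<open>H\<close> itself.\<close>
  have "((\<lambda>t. foldr F w (t *\<^sub>R z)) \<longlongrightarrow> foldr F w (1 *\<^sub>R z)) (at_left 1)"
    unfolding f by (intro tendsto_intros)
  moreover have "eventually (\<lambda>t::real. 0 < t \<and> t < 1) (at_left 1)"
    using eventually_at_left_real[of 0 1] by simp
  then have "eventually (\<lambda>t. foldr F w (t *\<^sub>R z) \<in> closure H) (at_left 1)"
    by eventually_elim (use ray closure_subset in \<open>auto intro!: subsetD[OF closure_subset]\<close>)
  ultimately have "foldr F w (1 *\<^sub>R z) \<in> closure H"
    by (intro Lim_in_closed_set[OF closed_closure]) auto
  then show "foldr F w z \<in> frontier H"
    using z(2) H_Om open_H by (auto simp: frontier_def interior_open)
qed

section \<open>Distances in the cell graph\<close>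

text \<open>Counting at most \<open>n\<close> steps makes bounds add under concatenation and
  includes equal cells with no step at all.\<close>

definition near :: "nat \<Rightarrow> nat \<Rightarrow> complex set \<Rightarrow> complex set \<Rightarrow> bool" where
  "near m n A B \<longleftrightarrow> (\<exists>k\<le>n. (A, B) \<in> {(A, B). adjacent m A B} ^^ k)"

lemma near_refl: "near m 0 A A"
  by (simp add: near_def)

lemma near_mono: "near m n A B \<Longrightarrow> n \<le> n' \<Longrightarrow> near m n' A B"
  unfolding near_def by (meson le_trans)

lemma near_trans: "near m a A B \<Longrightarrow> near m b B C \<Longrightarrow> near m (a + b) A C"
proof -
  assume "near m a A B" "near m b B C"
  then obtain k l where kl: "k \<le> a" "(A, B) \<in> {(A, B). adjacent m A B} ^^ k"
      "l \<le> b" "(B, C) \<in> {(A, B). adjacent m A B} ^^ l"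
    unfolding near_def by blast
  then have "(A, C) \<in> {(A, B). adjacent m A B} ^^ (k + l)"
    unfolding relpow_add by (intro relcompI)
  then show ?thesis
    unfolding near_def using kl(1,3) by (intro exI[of _ "k + l"]) simp
qed

lemma adjacent_sym: "adjacent m A B \<Longrightarrow> adjacent m B A"
  unfolding adjacent_def by metis

lemma near_sym:
  assumes "near m n A B"
  shows "near m n B A"
proof -
  have "(A, B) \<in> {(A, B). adjacent m A B} ^^ k \<Longrightarrow> (B, A) \<in> {(A, B). adjacent m A B} ^^ k" for k
  proof (induction k arbitrary: B)
    case (Suc k)
    then obtain C where C: "(A, C) \<in> {(A, B). adjacent m A B} ^^ k" "adjacent m C B"
      by auto
    then show ?case
      using relpow_Suc_I2[OF _ Suc.IH[OF C(1)], of B] adjacent_sym by blast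
  qed simp
  then show ?thesis
    using assms by (auto simp: near_def)
qed

text \<open>\<open>adjacent\<close> demands distinct cells; with at most one step, coinciding cells
  need no exclusion.\<close>

lemma near_edge:
  assumes "A \<in> cells m" "B \<in> cells m" "e edge_of A" "e' edge_of B"
    "glue_class m ` e = glue_class m ` e'"
  shows "near m 1 A B"
proof (cases "A = B")
  case True
  then show ?thesis
    using near_mono[OF near_refl] by simp
next
  case False
  then have "adjacent m A B"
    using assms unfolding adjacent_def by blast
  then show ?thesis
    unfolding near_def by (intro exI[of _ 1]) simp
qed

lemma cell_dist_le:
  assumes "near m n A B" "A \<in> cells m"
  shows "cell_dist m A B \<le> enat n"
proof -
  obtain k where k: "k \<le> n" "(A, B) \<in> {(A, B). adjacent m A B} ^^ k"
    using assms(1) by (auto simp: near_def)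
  then obtain f where f: "f 0 = A" "f k = B" "\<And>i. i < k \<Longrightarrow> adjacent m (f i) (f (Suc i))"
    by (auto simp: relpow_fun_conv)
  have "f i \<in> cells m" if "i \<le> k" for i
    using that f assms(2) by (cases i) (auto simp: adjacent_def)
  then have "is_path m k f"
    using f(3) by (auto simp: is_path_def)
  then have "cell_dist m A B \<le> enat k"
    unfolding cell_dist_def using f by (intro INF_lower) auto
  then show ?thesis
    using k(1) by (meson enat_ord_simps(1) order_trans)
qed

section \<open>The two kinds of adjacency\<close>

lemma Pw_cong: "map F u = map F v \<Longrightarrow> Pw u = Pw v"
  using foldr_map[of id F u] foldr_map[of id F v] by (simp add: Pw_def)

lemma cell_edge: "foldr F w ` closed_segment (vert n) (vert (n + 1)) edge_of Pw w"
  using edge_of_affine_image[OF edge_of_P, where r = "rho ^ length w" and a = "foldr F w 0"] rho_pos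
  unfolding Pw_def by (simp flip: foldr_F_affine)

lemma foldr_F_segment:
  "foldr F w ` closed_segment a b = closed_segment (foldr F w a) (foldr F w b)"
proof -
  have "(\<lambda>z. r *\<^sub>R z + c) ` closed_segment a b = closed_segment (r *\<^sub>R a + c) (r *\<^sub>R b + c)"
    for r and c :: complex
  proof -
    have "(\<lambda>z. r *\<^sub>R z + c) ` closed_segment a b = (+) c ` ((*\<^sub>R) r ` closed_segment a b)"
      by (simp add: image_image add.commute)
    also have "\<dots> = (+) c ` closed_segment (r *\<^sub>R a) (r *\<^sub>R b)"
      by (simp add: closed_segment_linear_image linear_scaleR)
    finally show ?thesis
      by (simp add: closed_segment_translation add.commute)
  qed
  then show ?thesis
    by (metis (no_types, lifting) foldr_F_affine image_cong)
qed

lemma glue_class_antipode: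
  assumes "antipodal m x y"
  shows "glue_class m x = glue_class m y"
  using assms unfolding glue_class_def
  by (auto intro: equivclp_trans equivclp_sym r_into_equivclp)

lemma uminus_foldr_replicate: "foldr F (replicate k (q + 4)) (- y) = - foldr F (replicate k q) y"
  by (simp only: foldr_F_replicate vert_add_4) simp

text \<open>The reflection about the centre of cell \<open>w\<close> carries an edge of the corner
  cell at \<open>q\<close> in subcell \<open>n\<close> to an edge of the corner cell at
  \<open>q + 4\<close> in subcell \<open>n + 4\<close>. The first edge lies on the frontier of the
  hole, so the two are glued pointwise.\<close>

lemma near_central_hole:
  assumes q: "q \<in> {n + 4, n + 5}" and m: "length w + Suc k = m"
  shows "near m 1 (Pw (w @ n # replicate k q)) (Pw (w @ (n + 4) # replicate k (q + 4)))"
proof (rule near_edge)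
  show "Pw (w @ n # replicate k q) \<in> cells m" "Pw (w @ (n + 4) # replicate k (q + 4)) \<in> cells m"
    using m by (auto intro!: Pw_in_cells)
  let ?S = "closed_segment (vert (n + 4)) (vert (n + 5))"
  let ?e = "foldr F (w @ n # replicate k q) ` ?S"
  let ?S' = "closed_segment (vert (n + 8)) (vert (n + 9))"
  let ?e' = "foldr F (w @ (n + 4) # replicate k (q + 4)) ` ?S'"
  have Suc: "n + 4 + 1 = n + 5" "n + 8 + 1 = n + 9"
    by simp_all
  show "?e edge_of Pw (w @ n # replicate k q)"
    using cell_edge[of _ "n + 4"] unfolding Suc .
  show "?e' edge_of Pw (w @ (n + 4) # replicate k (q + 4))"
    using cell_edge[of _ "n + 8"] unfolding Suc .
  define c where "c = foldr F w 0"
  obtain H where H: "H \<in> components (- Om m)" "symmetric_about H c" "bounded H"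
    "\<And>n z. z \<in> F n ` closed_segment (vert (n + 4)) (vert (n + 5)) \<Longrightarrow>
      foldr F w z \<in> Om m \<Longrightarrow> foldr F w z \<in> frontier H"
    using central_hole[of w k] m unfolding c_def by metis
  have S': "?S' = uminus ` ?S"
    using vert_add_4[of "n + 4"] vert_add_4[of "n + 5"]
      closed_segment_linear_image[of "uminus :: complex \<Rightarrow> complex" "vert (n + 4)" "vert (n + 5)"]
    by (simp add: linear_iff add.assoc del: vert_add_4)
  have antipode: "foldr F (w @ (n + 4) # replicate k (q + 4)) (- y) =
      2 * c - foldr F (w @ n # replicate k q) y" for y
  proof -
    have "foldr F w (- z) = 2 * c - foldr F w z" for z
      unfolding c_def foldr_F_affine[of w z] foldr_F_affine[of w "- z"] by simp
    moreover have "F (n + 4) (foldr F (replicate k (q + 4)) (- y)) = - F n (foldr F (replicate k q) y)"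
      unfolding uminus_foldr_replicate by (simp add: uminus_F)
    ultimately show ?thesis
      by (simp del: foldr_replicate)
  qed
  have "glue_class m (foldr F (w @ n # replicate k q) y) =
      glue_class m (foldr F (w @ (n + 4) # replicate k (q + 4)) (- y))" if y: "y \<in> ?S" for y
  proof -
    \<comment> \<open>\<open>vert q\<close> is an end point of the segment, so contracting towards
      it keeps the segment within itself.\<close>
    have stable: "foldr F (replicate j q) y \<in> ?S" for j
    proof (induction j)
      case (Suc j)
      have "vert q \<in> ?S"
        using q by auto
      then have "F q ` ?S \<subseteq> ?S"
        by (intro F_convex convex_closed_segment)
      then have "F q (foldr F (replicate j q) y) \<in> ?S"
        using Suc.IH by blast
      then show ?case
        by simp
    qed (use y in simp)
    have "y \<in> P"
      using y closed_segment_subset[OF vert_in_P vert_in_P convex_P] by blast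
    then have "foldr F (w @ n # replicate k q) y \<in> Om m"
      using m unfolding Om_eq by (intro UN_I[of "w @ n # replicate k q"] imageI) auto
    then have "foldr F (w @ n # replicate k q) y \<in> frontier H"
      using H(4)[of "F n (foldr F (replicate k q) y)" n] stable[of k] by (simp del: foldr_replicate)
    then have "antipodal m (foldr F (w @ n # replicate k q) y)
        (foldr F (w @ (n + 4) # replicate k (q + 4)) (- y))"
      unfolding antipodal_def antipode using H by blast
    then show ?thesis
      by (rule glue_class_antipode)
  qed
  then show "glue_class m ` ?e = glue_class m ` ?e'"
    unfolding S' image_image by (rule image_cong[OF refl])
qed

lemma F_affine: "F n (a *\<^sub>R x + (1 - a) *\<^sub>R y) = a *\<^sub>R F n x + (1 - a) *\<^sub>R F n y"
  by (simp add: F_eq algebra_simps)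

lemma F_shared_vertex': "F (n + 1) (vert (n + 6)) = F n (vert (n + 3))"
proof -
  have "vert n * (rho *\<^sub>R rot 6 + (1 - rho) *\<^sub>R rot 1) = vert n * (rho *\<^sub>R rot 3 + (1 - rho) *\<^sub>R rot 0)"
    by (rule arg_cong[of _ _ "(*) (vert n)"])
      (simp add: rot_table rot_table[simplified] rho_eq complex_eq_iff field_simps)
  then show ?thesis
    using vert_add[of n 0] by (simp add: F_eq vert_add[of n 6] vert_add[of n 1, simplified]
        vert_add[of n 3] algebra_simps rot_table)
qed

text \<open>Each pair \<open>(q, q')\<close> names one end of the common edge as seen from both
  octagons. Contracting towards this common point by the same ratio on both sides yields edges that
  coincide as sets, without any gluing.\<close>

lemma near_shared_edge:
  assumes "(q, q') \<in> {(n + 2, n + 7), (n + 3, n + 6)}" and m: "length w + Suc k = m"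
  shows "near m 1 (Pw (w @ n # replicate k q)) (Pw (w @ (n + 1) # replicate k q'))"
proof (rule near_edge)
  let ?u = "n # replicate k q" and ?v = "(n + 1) # replicate k q'"
  let ?e = "foldr F (w @ ?u) ` closed_segment (vert (n + 2)) (vert (n + 3))"
  let ?e' = "foldr F (w @ ?v) ` closed_segment (vert (n + 6)) (vert (n + 7))"
  show "Pw (w @ ?u) \<in> cells m" "Pw (w @ ?v) \<in> cells m"
    using m by (auto intro!: Pw_in_cells)
  have Suc: "n + 2 + 1 = n + 3" "n + 6 + 1 = n + 7"
    by simp_all
  show "?e edge_of Pw (w @ ?u)"
    using cell_edge[of _ "n + 2"] unfolding Suc .
  show "?e' edge_of Pw (w @ ?v)"
    using cell_edge[of _ "n + 6"] unfolding Suc .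
  have q: "F n (vert q) = F (n + 1) (vert q')"
    using assms(1) F_shared_vertex F_shared_vertex' by auto
  have "foldr F ?u z = foldr F ?v z'" if "F n z = F (n + 1) z'" for z z'
    using that q by (simp only: foldr.simps comp_apply foldr_F_replicate F_affine)
  then have "foldr F ?u (vert (n + 2)) = foldr F ?v (vert (n + 7))"
      "foldr F ?u (vert (n + 3)) = foldr F ?v (vert (n + 6))"
    using F_shared_vertex F_shared_vertex' by metis+
  then have "foldr F ?u ` closed_segment (vert (n + 2)) (vert (n + 3)) =
      foldr F ?v ` closed_segment (vert (n + 6)) (vert (n + 7))"
    unfolding foldr_F_segment by (metis closed_segment_commute)
  then have "?e = ?e'"
    unfolding foldr_append comp_def by (metis image_image)
  then show "glue_class m ` ?e = glue_class m ` ?e'"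
    by simp
qed

text \<open>The route crosses subcell \<open>q\<close> from corner \<open>q\<close> to corner
  \<open>q + 4\<close>, jumps over the central hole, and crosses subcell \<open>q + 4\<close> in the
  same direction. The lengths satisfy a(k + 1) = 2 a(k) + 1.\<close>

lemma near_opposite_corners:
  assumes "length w + k = m"
  shows "near m (2 ^ k - 1) (Pw (w @ replicate k q)) (Pw (w @ replicate k (q + 4)))"
  using assms
proof (induction k arbitrary: w)
  case 0
  then show ?case
    by (simp add: near_refl)
next
  case (Suc k)
  have "near m (2 ^ k - 1) (Pw (w @ q # replicate k q)) (Pw (w @ q # replicate k (q + 4)))"
    using Suc.IH[of "w @ [q]"] Suc.prems by simp
  moreover have "Pw (w @ (q + 4) # replicate k (q + 4 + 4)) = Pw (w @ (q + 4) # replicate k q)"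
    using F_cong_mod[of "q + 4 + 4" q] by (intro Pw_cong) simp
  then have "near m 1 (Pw (w @ q # replicate k (q + 4))) (Pw (w @ (q + 4) # replicate k q))"
    using near_central_hole[of "q + 4" q w k m] Suc.prems by simp
  moreover have "near m (2 ^ k - 1) (Pw (w @ (q + 4) # replicate k q))
      (Pw (w @ (q + 4) # replicate k (q + 4)))"
    using Suc.IH[of "w @ [q + 4]"] Suc.prems by simp
  ultimately have "near m (2 ^ k - 1 + 1 + (2 ^ k - 1)) (Pw (w @ q # replicate k q))
      (Pw (w @ (q + 4) # replicate k (q + 4)))"
    using near_trans by blast
  moreover have "2 ^ k - 1 + 1 + (2 ^ k - 1) = 2 ^ Suc k - (1::nat)"
    by simp
  ultimately show ?case
    by simp
qed

text \<open>The first assumption says \<open>b = 2 ^ (k - 1) * (k + 2) - 1\<close>, in a form that includes \<open>k = 0\<close>.\<close>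

lemma near_cells:
  assumes "2 * b + 2 = 2 ^ k * (k + 2)" "length u = k" "length v = k" "length w + k = m"
  shows "near m b (Pw (w @ u)) (Pw (w @ v))"
  using assms
proof (induction k arbitrary: b u v w)
  case 0
  then show ?case
    by (simp add: near_refl)
next
  case (Suc k)
  \<comment> \<open>Evenness comes from \<open>2 ^ k\<close> for positive \<open>k\<close> and from
    \<open>k + 2\<close> for \<open>k = 0\<close>; hence the bound \<open>b'\<close> for level
    \<open>k\<close> is a natural number.\<close>
  have "even (2 ^ k * (k + 2))" "2 \<le> 2 ^ k * (k + 2)"
    using mult_le_mono[of 1 "2 ^ k" 2 "k + 2"] by (cases k; simp)+
  then obtain b' where b': "2 * b' + 2 = 2 ^ k * (k + 2)"
    by (metis add.commute dvdE le_Suc_ex mult_2_right numeral_2_eq_2 dvd_add_right_iff dvd_refl)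
  \<comment> \<open>The budget covers two journeys inside the end cells, two adjacency steps, and
    \<open>2 ^ k - 1\<close> steps between opposite corners of an intermediate cell.\<close>
  then have b: "b = 2 * b' + 2 ^ k + 1"
    using Suc.prems(1) by (simp add: algebra_simps)
  have m: "length w + Suc k = m"
    by fact
  have inner: "near m b' (Pw (w @ n # s)) (Pw (w @ n # t))" if "length s = k" "length t = k" for n s t
    using Suc.IH[OF b' that, of "w @ [n]"] m by simp
  have main: "near m b (Pw (w @ i # s)) (Pw (w @ (i + d) # t))"
    if st: "length s = k" "length t = k" and d: "d \<in> {0, 1, 2, 3, 4}" for i d s t
  proof -
    let ?c = "\<lambda>n q. Pw (w @ n # replicate k q)"
    have c_mod: "?c n (q + 8) = ?c n q" for n q
      using F_cong_mod[of "q + 8" q] by (intro Pw_cong) simp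
    have start: "near m b' (Pw (w @ i # s)) (?c i q)" for q
      using st by (intro inner) simp_all
    have finish: "near m b' (?c n q) (Pw (w @ n # t))" for n q
      using st by (intro inner) simp_all
    consider "d = 0" | "d = 1" | "d = 2" | "d = 3" | "d = 4"
      using d by auto
    then show ?thesis
    proof cases
      case 1
      have "near m b' (Pw (w @ i # s)) (Pw (w @ i # t))"
        using st by (rule inner)
      then show ?thesis
        unfolding 1 add_0_right by (rule near_mono) (simp add: b)
    next
      case 2
      have "near m 1 (?c i (i + 2)) (?c (i + 1) (i + 7))"
        using m by (intro near_shared_edge) auto
      then have "near m (b' + 1 + b') (Pw (w @ i # s)) (Pw (w @ (i + 1) # t))"
        by (rule near_trans[OF near_trans[OF start] finish])
      then show ?thesis
        unfolding 2 by (rule near_mono) (simp add: b)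
    next
      \<comment> \<open>Subcell \<open>i + 1\<close> is entered at corner \<open>i + 7\<close> and
        left at the opposite corner \<open>i + 3\<close>; this is the case that exhausts the
        budget.\<close>
      case 3
      have step1: "near m 1 (?c i (i + 2)) (?c (i + 1) (i + 7))"
        using m by (intro near_shared_edge) auto
      have step2: "near m (2 ^ k - 1) (?c (i + 1) (i + 7)) (?c (i + 1) (i + 3))"
        using near_opposite_corners[of "w @ [i + 1]" k m "i + 7"] m c_mod[of "i + 1" "i + 3"] by simp
      have step3: "near m 1 (?c (i + 1) (i + 3)) (?c (i + 2) (i + 8))"
        using near_shared_edge[of "i + 3" "i + 8" "i + 1" w k m] m by (simp add: numeral_eq_Suc)
      have "near m (b' + 1 + (2 ^ k - 1) + 1 + b') (Pw (w @ i # s)) (Pw (w @ (i + 2) # t))"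
        by (rule near_trans[OF near_trans[OF near_trans[OF near_trans[OF start step1] step2] step3] finish])
      then show ?thesis
        unfolding 3 by (rule near_mono) (simp add: b)
    next
      \<comment> \<open>The route jumps over the hole to subcell \<open>i + 4\<close>, which is
        entered and left at the same corner \<open>i + 9\<close>, and then steps back to
        \<open>i + 3\<close>.\<close>
      case 4
      have "near m 1 (?c i (i + 5)) (?c (i + 4) (i + 5 + 4))"
        using m by (intro near_central_hole) auto
      then have step1: "near m 1 (?c i (i + 5)) (?c (i + 4) (i + 9))"
        by (simp add: add.assoc)
      have "near m 1 (?c (i + 3) (i + 6)) (?c (i + 3 + 1) (i + 9))"
        using m by (intro near_shared_edge) auto
      moreover have "i + 3 + 1 = i + 4"
        by simp
      ultimately have step2: "near m 1 (?c (i + 4) (i + 9)) (?c (i + 3) (i + 6))"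
        by (metis near_sym)
      have "near m (b' + 1 + 1 + b') (Pw (w @ i # s)) (Pw (w @ (i + 3) # t))"
        by (rule near_trans[OF near_trans[OF near_trans[OF start step1] step2] finish])
      then show ?thesis
        unfolding 4 by (rule near_mono) (simp add: b)
    next
      case 5
      have "near m 1 (?c i (i + 4)) (?c (i + 4) (i + 4 + 4))"
        using m by (intro near_central_hole) auto
      then have "near m (b' + 1 + b') (Pw (w @ i # s)) (Pw (w @ (i + 4) # t))"
        by (rule near_trans[OF near_trans[OF start] finish])
      then show ?thesis
        unfolding 5 by (rule near_mono) (simp add: b)
    qed
  qed
  obtain i s j t where uv: "u = i # s" "v = j # t" "length s = k" "length t = k"
    using Suc.prems by (auto simp: length_Suc_conv)
  obtain d where d: "d < 8" "j mod 8 = (i + d) mod 8"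
    using ex_offset by metis
  show ?case
  proof (cases "d \<le> 4")
    case True
    have "Pw (w @ (i + d) # t) = Pw (w @ v)"
      using F_cong_mod[OF d(2)] by (intro Pw_cong) (simp add: uv)
    then show ?thesis
      using main[OF uv(3,4), of d i] True less_8_cases[OF d(1)] uv(1) by auto
  next
    case False
    \<comment> \<open>Offsets above 4 are handled by exchanging the two cells, which turns
      \<open>d\<close> into \<open>8 - d\<close>.\<close>
    have "i + d + (8 - d) = i + 8"
      using d(1) by simp
    then have "i mod 8 = (i + d + (8 - d)) mod 8"
      by (simp only: mod_add_self2)
    also have "\<dots> = (j + (8 - d)) mod 8"
      unfolding mod_add_left_eq[of "i + d" 8, symmetric] d(2)[symmetric] by (rule mod_add_left_eq)
    finally have "F i = F (j + (8 - d))"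
      by (rule F_cong_mod)
    then have "Pw (w @ (j + (8 - d)) # s) = Pw (w @ u)"
      by (intro Pw_cong) (simp add: uv)
    moreover have "8 - d \<in> {0, 1, 2, 3, 4}"
      using False d(1) by auto
    ultimately have "near m b (Pw (w @ v)) (Pw (w @ u))"
      using main[OF uv(4,3), of "8 - d" j] uv(2) by simp
    then show ?thesis
      by (rule near_sym)
  qed
qed

theorem corollary9p3:
  fixes m :: nat
  assumes "m > 0"
  shows "diam m \<le> enat (2 ^ (m - 1) * (m + 2) - 1)"
proof -
  let ?b = "2 ^ (m - 1) * (m + 2) - 1 :: nat"
  \<comment> \<open>The product is positive, so the truncated \<open>- 1\<close> is a genuine
    subtraction; \<open>near_cells\<close> is then applied with the empty common prefix.\<close>
  have "2 * ?b + 2 = 2 * (2 ^ (m - 1) * (m + 2))"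
    using Suc_leI[of 0 "2 ^ (m - 1) * (m + 2)"] by simp
  also have "\<dots> = 2 ^ m * (m + 2)"
    using assms by (cases m) simp_all
  finally have "2 * ?b + 2 = 2 ^ m * (m + 2)" .
  then have "near m ?b A B" if "A \<in> cells m" "B \<in> cells m" for A B
    using near_cells[of ?b m _ _ "[]" m] that by (auto simp: cells_eq)
  then show ?thesis
    unfolding diam_def by (intro SUP_least cell_dist_le)
qed

end
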